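(* Let $P$ be a finite poset with $n$ elements and $\theta:P\to[n]$ a bijective labeling. Then $$\tilde K_{P,\theta}=\sum_{N\ge n}\ \sum_{w\in\tilde{\mathcal J}_N(P,\theta)}\tilde L_{\mathcal C(w)}.$$
   Context: $\mathbb P$ is the set of positive integers, $[n]=\{1,\dots,n\}$, and $\tilde{\mathbb P}$ is the set of nonempty finite subsets of $\mathbb P$. For nonempty finite sets $a,b$ of positive integers write $a\le b$ if $\max(a)\le\min(b)$ and $a<b$ if $\max(a)<\min(b)$. A $(P,\theta)$-set-valued partition is a map $\sigma:P\to\tilde{\mathbb P}$ such that for each covering relation $s\lessdot t$ in $P$: $\sigma(s)\le\sigma(t)$ if $\theta(s)<\theta(t)$, and $\sigma(s)<\sigma(t)$ if $\theta(t)<\theta(s)$. Let $\tilde{\mathcal A}(P,\theta)$ be the set of these, let $\sigma^{-1}(i)=\{x\in P: i\in\sigma(x)\}$, and set $$\tilde K_{P,\theta}(x_1,x_2,\dots)=\sum_{\sigma\in\tilde{\mathcal A}(P,\theta)}x_1^{\#\sigma^{-1}(1)}x_2^{\#\sigma^{-1}(2)}\cdots\in\mathbb Z[[x_1,x_2,\dots]].$$ A composition $\alpha=(\alpha_1,\dots,\alpha_k)$ of $m$ corresponds to the subset $D(\alpha)=\{\alpha_1,\alpha_1+\alpha_2,\dots,\alpha_1+\cdots+\alpha_{k-1}\}\subset[m-1]$; the inverse bijection is denoted $\mathcal C$. For a word $w=w_1\cdots w_m$ of positive integers with $w_i\ne w_{i+1}$ for all $i$, $\mathrm{Des}(w)=\{i\in[m-1]: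 w_i>w_{i+1}\}$ and $\mathcal C(w)=\mathcal C(\mathrm{Des}(w))$, a composition of the length $m$. For a composition $\alpha$ of $m$, let $C=\{c_1<\cdots<c_m\}$ be a chain and $w\in S_m$ any permutation with $\mathcal C(w)=\alpha$, viewed as the labeling $c_i\mapsto w_i$. The multi-fundamental quasisymmetric function is $\tilde L_\alpha=\tilde K_{C,w}$ (it depends only on $\alpha$). A linear multi-extension of $P$ by $[N]$ ($N\ge n$) is a map $e$ from $P$ to nonempty subsets of $[N]$ such that (1) $e(x)<e(y)$ if $x<y$ in $P$; (2) each $i\in[N]$ lies in $e(x)$ for exactly one $x\in P$, denoted $e^{-1}(i)$; (3) no $e(x)$ contains both $i$ and $i+1$ for any $i$. Then $\tilde{\mathcal J}_N(P,\theta)$ is the set of words $\theta(e^{-1}(1))\,\theta(e^{-1}(2))\cdots\theta(e^{-1}(N))$, as $e$ ranges over the linear multi-extensions of $P$ by $[N]$. *)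

theory Defs
  imports
    "HOL-Analysis.Analysis"
    "HOL-Library.Function_Algebras"
    "HOL-Library.Poly_Mapping"
    "HOL-Combinatorics.Multiset_Permutations"
begin

section \<open>Formal power series in countably many variables\<close>

text \<open>
  A series in \<open>\<int>[[x\<^sub>1, x\<^sub>2, \<dots>]]\<close> is its coefficient function on exponent vectors.
  Addition is pointwise and the topology is the product topology with \<open>int\<close> discrete, so the
  infinite sums below are the usual coefficientwise ones (see \<open>has_sum_mseries_iff\<close>).
  The pointwise multiplication that the library puts on functions is not multiplication of series;
  it is not used. The index \<open>0\<close> is available as a variable, but never occurs.
\<close>

type_synonym mseries = "(nat \<Rightarrow>\<^sub>0 nat) \<Rightarrow> int"

definition monomial_series :: "(nat \<Rightarrow>\<^sub>0 nat) \<Rightarrow> mseries" where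
  "monomial_series m = (\<lambda>m'. if m' = m then 1 else 0)"

lemma open_vimage_apply: "open U \<Longrightarrow> open ((\<lambda>h::'a \<Rightarrow> 'b::topological_space. h x) -` U)"
  by (erule open_vimage) (rule continuous_on_product_coordinates)

instance "fun" :: (type, t0_space) t0_space
proof
  fix f g :: "'a \<Rightarrow> 'b"
  assume "f \<noteq> g"
  then obtain x where x: "f x \<noteq> g x" by auto
  obtain U where U: "open U" "\<not> (f x \<in> U \<longleftrightarrow> g x \<in> U)"
    using x separation_t0 by blast
  show "\<exists>U. open U \<and> \<not> (f \<in> U \<longleftrightarrow> g \<in> U)"
    by (intro exI[of _ "(\<lambda>h. h x) -` U"]) (use U in \<open>auto simp: open_vimage_apply\<close>)
qed

instance "fun" :: (type, t1_space) t1_space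
proof
  fix f g :: "'a \<Rightarrow> 'b"
  assume "f \<noteq> g"
  then obtain x where x: "f x \<noteq> g x" by auto
  obtain U where U: "open U" "f x \<in> U" "g x \<notin> U"
    using t1_space[OF x] by blast
  show "\<exists>U. open U \<and> f \<in> U \<and> g \<notin> U"
    by (intro exI[of _ "(\<lambda>h. h x) -` U"]) (use U in \<open>auto simp: open_vimage_apply\<close>)
qed

instance "fun" :: (type, t2_space) t2_space
proof
  fix f g :: "'a \<Rightarrow> 'b"
  assume "f \<noteq> g"
  then obtain x where x: "f x \<noteq> g x" by auto
  obtain U V where UV: "open U" "open V" "f x \<in> U" "g x \<in> V" "U \<inter> V = {}"
    using hausdorff[OF x] by blast
  show "\<exists>U V. open U \<and> open V \<and> f \<in> U \<and> g \<in> V \<and> U \<inter> V = {}"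
    by (intro exI[of _ "(\<lambda>h. h x) -` U"] exI[of _ "(\<lambda>h. h x) -` V"])
       (use UV in \<open>auto simp: open_vimage_apply\<close>)
qed

lemma sum_fun_apply: "(\<Sum>a\<in>F. f a) m = (\<Sum>a\<in>F. (f a m :: 'b :: comm_monoid_add))"
  by (induction F rule: infinite_finite_induct) auto

lemma has_sum_mseries_iff:
  fixes f :: "'a \<Rightarrow> mseries"
  shows "(f has_sum s) A \<longleftrightarrow> (\<forall>m. ((\<lambda>a. f a m) has_sum s m) A)"
proof -
  have "(f has_sum s) A \<longleftrightarrow> limitin euclidean (sum f) s (finite_subsets_at_top A)"
    by (simp add: has_sum_def)
  also have "\<dots> \<longleftrightarrow>
      (\<forall>m. limitin euclidean (\<lambda>F. sum f F m) (s m) (finite_subsets_at_top A))"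
    unfolding euclidean_product_topology[symmetric] limitin_componentwise by simp
  finally show ?thesis
    by (simp add: has_sum_def sum_fun_apply[abs_def])
qed

section \<open>Set-valued partitions\<close>

text \<open>A poset is a carrier \<open>P\<close> with a relation \<open>r\<close> such that \<open>partial_order_on P r\<close>.\<close>

definition covers :: "'a set \<Rightarrow> 'a rel \<Rightarrow> 'a \<Rightarrow> 'a \<Rightarrow> bool" where
  "covers P r s t \<longleftrightarrow> s \<in> P \<and> t \<in> P \<and> (s, t) \<in> r \<and> s \<noteq> t \<and>
     \<not> (\<exists>u\<in>P. (s, u) \<in> r \<and> s \<noteq> u \<and> (u, t) \<in> r \<and> u \<noteq> t)"

definition set_le :: "nat set \<Rightarrow> nat set \<Rightarrow> bool" where
  "set_le a b \<longleftrightarrow> Max a \<le> Min b"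

definition set_less :: "nat set \<Rightarrow> nat set \<Rightarrow> bool" where
  "set_less a b \<longleftrightarrow> Max a < Min b"

text \<open>Maps on \<open>P\<close> are extensional functions, so that each is counted once.\<close>

definition set_valued_partitions :: "'a set \<Rightarrow> 'a rel \<Rightarrow> ('a \<Rightarrow> nat) \<Rightarrow> ('a \<Rightarrow> nat set) set" where
  "set_valued_partitions P r \<theta> =
     {\<sigma> \<in> P \<rightarrow>\<^sub>E {a. finite a \<and> a \<noteq> {} \<and> a \<subseteq> {1..}}.
        \<forall>s t. covers P r s t \<longrightarrow>
          (\<theta> s < \<theta> t \<longrightarrow> set_le (\<sigma> s) (\<sigma> t)) \<and>
          (\<theta> t < \<theta> s \<longrightarrow> set_less (\<sigma> s) (\<sigma> t))}"

text \<open>The function under \<open>Abs_poly_mapping\<close> has finite support when \<open>P\<close> is finite, see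
  \<open>lookup_exponents\<close>.\<close>

definition exponents :: "'a set \<Rightarrow> ('a \<Rightarrow> nat set) \<Rightarrow> (nat \<Rightarrow>\<^sub>0 nat)" where
  "exponents P \<sigma> = Abs_poly_mapping (\<lambda>i. card {x \<in> P. i \<in> \<sigma> x})"

definition Ktilde :: "'a set \<Rightarrow> 'a rel \<Rightarrow> ('a \<Rightarrow> nat) \<Rightarrow> mseries" where
  "Ktilde P r \<theta> = (\<Sum>\<^sub>\<infinity>\<sigma>\<in>set_valued_partitions P r \<theta>. monomial_series (exponents P \<sigma>))"

lemma lookup_exponents:
  assumes "finite P" "\<sigma> \<in> set_valued_partitions P r \<theta>"
  shows "Poly_Mapping.lookup (exponents P \<sigma>) i = card {x \<in> P. i \<in> \<sigma> x}"
proof -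
  have "{j. card {x \<in> P. j \<in> \<sigma> x} \<noteq> 0} \<subseteq> (\<Union>x\<in>P. \<sigma> x)"
  proof
    fix j assume "j \<in> {j. card {x \<in> P. j \<in> \<sigma> x} \<noteq> 0}"
    then have "{x \<in> P. j \<in> \<sigma> x} \<noteq> {}"
      by (metis (mono_tags, lifting) card.empty mem_Collect_eq)
    then show "j \<in> (\<Union>x\<in>P. \<sigma> x)" by auto
  qed
  moreover have "finite (\<Union>x\<in>P. \<sigma> x)"
    using assms by (auto simp: set_valued_partitions_def PiE_def Pi_def)
  ultimately have "finite {j. card {x \<in> P. j \<in> \<sigma> x} \<noteq> 0}"
    by (rule finite_subset)
  then show ?thesis
    by (simp add: exponents_def)
qed

lemma finite_exponents_fibre:
  assumes "finite P"
  shows "finite {\<sigma> \<in> set_valued_partitions P r \<theta>. exponents P \<sigma> = m}"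
proof (rule finite_subset)
  show "{\<sigma> \<in> set_valued_partitions P r \<theta>. exponents P \<sigma> = m} \<subseteq> P \<rightarrow>\<^sub>E Pow (Poly_Mapping.keys m)"
  proof
    fix \<sigma> assume *: "\<sigma> \<in> {\<sigma> \<in> set_valued_partitions P r \<theta>. exponents P \<sigma> = m}"
    have "i \<in> Poly_Mapping.keys m" if "x \<in> P" "i \<in> \<sigma> x" for x i
    proof -
      have "card {y \<in> P. i \<in> \<sigma> y} \<noteq> 0"
        using that assms by auto
      moreover have "Poly_Mapping.lookup m i = card {y \<in> P. i \<in> \<sigma> y}"
        using * lookup_exponents[OF assms] by auto
      ultimately show ?thesis
        unfolding in_keys_iff by linarith
    qed
    then show "\<sigma> \<in> P \<rightarrow>\<^sub>E Pow (Poly_Mapping.keys m)"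
      using * by (auto simp: set_valued_partitions_def PiE_def)
  qed
  show "finite (P \<rightarrow>\<^sub>E Pow (Poly_Mapping.keys m))"
    using assms by (intro finite_PiE) auto
qed

lemma Ktilde_has_sum_coeff:
  assumes "finite P"
  shows "((\<lambda>\<sigma>. monomial_series (exponents P \<sigma>)) has_sum
      (\<lambda>m. int (card {\<sigma> \<in> set_valued_partitions P r \<theta>. exponents P \<sigma> = m})))
    (set_valued_partitions P r \<theta>)"
  unfolding has_sum_mseries_iff
proof
  fix m
  let ?F = "{\<sigma> \<in> set_valued_partitions P r \<theta>. exponents P \<sigma> = m}"
  have "((\<lambda>\<sigma>. monomial_series (exponents P \<sigma>) m) has_sum
      (\<Sum>\<sigma>\<in>?F. monomial_series (exponents P \<sigma>) m)) ?F"
    using finite_exponents_fibre[OF assms] by (rule has_sum_finite)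
  also have "(\<Sum>\<sigma>\<in>?F. monomial_series (exponents P \<sigma>) m) = int (card ?F)"
    by (simp add: monomial_series_def)
  finally show "((\<lambda>\<sigma>. monomial_series (exponents P \<sigma>) m) has_sum int (card ?F))
      (set_valued_partitions P r \<theta>)"
    by (rule has_sum_cong_neutral[THEN iffD1, rotated -1]) (auto simp: monomial_series_def)
qed

lemma Ktilde_coeff:
  "finite P \<Longrightarrow>
    Ktilde P r \<theta> m = int (card {\<sigma> \<in> set_valued_partitions P r \<theta>. exponents P \<sigma> = m})"
  unfolding Ktilde_def by (simp add: infsumI[OF Ktilde_has_sum_coeff])

section \<open>Compositions, descents and multi-fundamental series\<close>

definition compositions :: "nat \<Rightarrow> nat list set" where
  "compositions m = {\<alpha>. sum_list \<alpha> = m \<and> (\<forall>a\<in>set \<alpha>. 0 < a)}"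

definition comp_to_set :: "nat list \<Rightarrow> nat set" where
  "comp_to_set \<alpha> = (\<lambda>j. sum_list (take j \<alpha>)) ` {1..<length \<alpha>}"

definition set_to_comp :: "nat \<Rightarrow> nat set \<Rightarrow> nat list" where
  "set_to_comp m = the_inv_into (compositions m) comp_to_set"

text \<open>Words are lists; the \<open>i\<close>-th letter \<open>w\<^sub>i\<close> (counting from 1) is \<open>w ! (i - 1)\<close>.\<close>

definition Des :: "nat list \<Rightarrow> nat set" where
  "Des w = {i. 1 \<le> i \<and> i < length w \<and> w ! (i - 1) > w ! i}"

definition word_comp :: "nat list \<Rightarrow> nat list" where
  "word_comp w = set_to_comp (length w) (Des w)"

text \<open>The chain is \<open>{1..m}\<close> with its usual order. The permutation is arbitrary; the series depends
  only on \<open>\<alpha>\<close>.\<close>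

definition Ltilde :: "nat list \<Rightarrow> mseries" where
  "Ltilde \<alpha> =
     (let m = sum_list \<alpha>;
          w = (SOME w. w \<in> permutations_of_set {1..m} \<and> word_comp w = \<alpha>)
      in Ktilde {1..m} {(i, j). i \<in> {1..m} \<and> j \<in> {1..m} \<and> i \<le> j} (\<lambda>i. w ! (i - 1)))"

section \<open>Linear multi-extensions\<close>

definition linear_multi_extensions :: "'a set \<Rightarrow> 'a rel \<Rightarrow> nat \<Rightarrow> ('a \<Rightarrow> nat set) set" where
  "linear_multi_extensions P r N =
     {e \<in> P \<rightarrow>\<^sub>E {a. a \<noteq> {} \<and> a \<subseteq> {1..N}}.
        (\<forall>x\<in>P. \<forall>y\<in>P. (x, y) \<in> r \<and> x \<noteq> y \<longrightarrow> set_less (e x) (e y)) \<and>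
        (\<forall>i\<in>{1..N}. \<exists>!x. x \<in> P \<and> i \<in> e x) \<and>
        (\<forall>x\<in>P. \<forall>i. \<not> (i \<in> e x \<and> i + 1 \<in> e x))}"

definition ext_word :: "'a set \<Rightarrow> ('a \<Rightarrow> nat) \<Rightarrow> nat \<Rightarrow> ('a \<Rightarrow> nat set) \<Rightarrow> nat list" where
  "ext_word P \<theta> N e = map (\<lambda>i. \<theta> (THE x. x \<in> P \<and> i \<in> e x)) [1..<N+1]"

definition multi_Jordan_Hoelder :: "'a set \<Rightarrow> 'a rel \<Rightarrow> ('a \<Rightarrow> nat) \<Rightarrow> nat \<Rightarrow> nat list set" where
  "multi_Jordan_Hoelder P r \<theta> N = ext_word P \<theta> N ` linear_multi_extensions P r N"

lemma finite_multi_Jordan_Hoelder: "finite P \<Longrightarrow> finite (multi_Jordan_Hoelder P r \<theta> N)"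
  unfolding multi_Jordan_Hoelder_def linear_multi_extensions_def
  by (intro finite_imageI finite_subset[OF Collect_restrict] finite_PiE)
     (auto intro: finite_subset[of _ "Pow {1..N}"])

end

theory Submission
  imports Defs
begin

text \<open>
  A map \<open>\<sigma>\<close> is recorded by its set of cells \<open>(i, \<theta> x)\<close> with \<open>i \<in> \<sigma> x\<close>. Listing the cells
  lexicographically and merging maximal runs of cells with the same second component gives a list of
  blocks \<open>(a\<^sub>1, T\<^sub>1), \<dots>, (a\<^sub>N, T\<^sub>N)\<close> with \<open>a\<^sub>j \<noteq> a\<^sub>j\<^sub>+\<^sub>1\<close>, which determines the set of cells and is
  determined by it. The map \<open>\<sigma>\<close> is a \<open>(P, \<theta>)\<close>-set-valued partition iff the word \<open>a\<^sub>1 \<dots> a\<^sub>N\<close> comes from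
  a linear multi-extension, while for a given word \<open>w\<close> the sequences \<open>T\<^sub>1, \<dots>, T\<^sub>N\<close> that occur are
  exactly the set-valued partitions of a chain labelled by a permutation with the descents of \<open>w\<close>.
  Both correspondences preserve exponents.
\<close>

section \<open>Block lists\<close>

text \<open>A block is a pair (letter, labels), but a cell is a pair (label, letter): \<open>precedes\<close> compares
  the cells of two blocks lexicographically, by label first.\<close>

definition precedes :: "nat \<times> nat set \<Rightarrow> nat \<times> nat set \<Rightarrow> bool" where
  "precedes p q \<longleftrightarrow> (\<forall>i\<in>snd p. \<forall>j\<in>snd q. i < j \<or> i = j \<and> fst p < fst q)"

text \<open>Distinct neighbouring letters make the runs maximal. A letter may recur further on, and
  \<open>precedes\<close> then forces the two label sets to be disjoint, with all labels of the
  earlier block smaller.\<close>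

definition block_list :: "(nat \<times> nat set) list \<Rightarrow> bool" where
  "block_list B \<longleftrightarrow> distinct_adj (map fst B) \<and> sorted_wrt precedes B \<and>
     (\<forall>p\<in>set B. finite (snd p) \<and> snd p \<noteq> {})"

definition cells :: "(nat \<times> nat set) list \<Rightarrow> (nat \<times> nat) set" where
  "cells B = {(i, a). \<exists>T. (a, T) \<in> set B \<and> i \<in> T}"

text \<open>A label of the middle block serves as the intermediate term of the lexicographic order.
  Through an empty block the claim would fail, since an empty block precedes and follows everything
  vacuously.\<close>

lemma precedes_trans: "precedes p q \<Longrightarrow> precedes q s \<Longrightarrow> snd q \<noteq> {} \<Longrightarrow> precedes p s"
proof -
  assume *: "precedes p q" "precedes q s" and "snd q \<noteq> {}"
  then obtain j where "j \<in> snd q" by blast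
  show "precedes p s"
    unfolding precedes_def
  proof (intro ballI)
    fix i k assume "i \<in> snd p" "k \<in> snd s"
    then have "i < j \<or> i = j \<and> fst p < fst q" "j < k \<or> j = k \<and> fst q < fst s"
      using * \<open>j \<in> snd q\<close> unfolding precedes_def by blast+
    then show "i < k \<or> i = k \<and> fst p < fst s" by auto
  qed
qed

text \<open>A tie between labels is allowed exactly when the letters increase. The two cases in the
  definition of a set-valued partition thus become one relation, which is transitive through
  nonempty blocks.\<close>

lemma precedes_iff:
  assumes "finite T" "T \<noteq> {}" "finite U" "U \<noteq> {}" "a \<noteq> b"
  shows "precedes (a, T) (b, U) \<longleftrightarrow> (a < b \<longrightarrow> set_le T U) \<and> (b < a \<longrightarrow> set_less T U)"
proof -
  have "set_le T U \<longleftrightarrow> (\<forall>i\<in>T. \<forall>j\<in>U. i \<le> j)" "set_less T U \<longleftrightarrow> (\<forall>i\<in>T. \<forall>j\<in>U. i < j)"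
    using assms by (simp_all add: set_le_def set_less_def) blast+
  note le_less_iff = this
  consider "a < b" | "b < a" using assms(5) by linarith
  then show ?thesis
  proof cases
    case 1
    then show ?thesis using le_less_iff by (simp add: precedes_def le_less)
  next
    case 2
    then show ?thesis using le_less_iff by (simp add: precedes_def)
  qed
qed

lemma cells_Nil [simp]: "cells [] = {}"
  by (simp add: cells_def)

lemma cells_Cons [simp]: "cells ((a, T) # B) = T \<times> {a} \<union> cells B"
  by (auto simp: cells_def)

lemma snd_image_cells: "block_list B \<Longrightarrow> snd ` cells B = set (map fst B)"
proof -
  assume *: "block_list B"
  have "a \<in> snd ` cells B" if "(a, T) \<in> set B" for a T
  proof -
    have "T \<noteq> {}" using * that by (auto simp: block_list_def)
    then obtain i where "i \<in> T" by blast
    then show ?thesis using that by (intro image_eqI[of _ _ "(i, a)"]) (auto simp: cells_def)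
  qed
  moreover have "snd ` cells B \<subseteq> fst ` set B" by (force simp: cells_def)
  ultimately show ?thesis by auto
qed

lemma block_list_Nil [simp]: "block_list []"
  by (simp add: block_list_def)

text \<open>The tail enters the order condition only through its set of cells, so inductions can
  exchange a tail for the cells it contains.\<close>

lemma block_list_Cons:
  "block_list ((a, T) # B) \<longleftrightarrow> (B = [] \<or> a \<noteq> fst (hd B)) \<and> finite T \<and> T \<noteq> {} \<and>
     (\<forall>i\<in>T. \<forall>(j, b)\<in>cells B. i < j \<or> i = j \<and> a < b) \<and> block_list B"
proof -
  have "(\<forall>q\<in>set B. precedes (a, T) q) \<longleftrightarrow> (\<forall>i\<in>T. \<forall>(j, b)\<in>cells B. i < j \<or> i = j \<and> a < b)"
    unfolding precedes_def cells_def by (simp add: Ball_def) blast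
  then show ?thesis
    unfolding block_list_def by (cases "B = []") (auto simp: distinct_adj_Cons hd_map)
qed

lemma block_list_ConsD:
  assumes "block_list ((a, T) # B)"
  shows "block_list B" "finite T" "T \<noteq> {}" "B \<noteq> [] \<Longrightarrow> a \<noteq> fst (hd B)"
    and "i \<in> T \<Longrightarrow> (j, b) \<in> cells B \<Longrightarrow> i < j \<or> i = j \<and> a < b"
  using assms unfolding block_list_Cons by blast+

section \<open>Existence and uniqueness of the block list of a finite set of cells\<close>

text \<open>The lexicographically least cell is removed, and then put back in front of a block list
  of the remaining cells.\<close>

lemma block_list_exists:
  assumes "finite G"
  shows "\<exists>B. block_list B \<and> cells B = G"
  using assms
proof (induction "card G" arbitrary: G)
  case 0
  then show ?case by (intro exI[of _ "[]"]) auto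
next
  case (Suc k)
  then have ne: "G \<noteq> {}" by auto
  \<comment> \<open>The least label, and below the least letter \<open>a\<close> at that label, give
    the lexicographic minimum of \<open>G\<close>.\<close>
  define i where "i = Min (fst ` G)"
  have i: "i \<in> fst ` G" "\<And>p. p \<in> G \<Longrightarrow> i \<le> fst p"
    unfolding i_def using ne Suc.prems by auto
  define A where "A = {b. (i, b) \<in> G}"
  have "A \<subseteq> snd ` G" by (force simp: A_def)
  then have finA: "finite A" using Suc.prems by (auto intro: finite_subset)
  have "A \<noteq> {}" using i(1) by (auto simp: A_def)
  define a where "a = Min A"
  have a: "(i, a) \<in> G" "\<And>b. (i, b) \<in> G \<Longrightarrow> a \<le> b"
    using Min_in[OF finA \<open>A \<noteq> {}\<close>] finA by (auto simp: a_def A_def)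
  have min: "i < j \<or> i = j \<and> a < b" if "(j, b) \<in> G - {(i, a)}" for j b
  proof -
    have "i \<le> j" using i(2)[of "(j, b)"] that by simp
    moreover have "a < b" if "i = j" using a(2)[of b] that \<open>(j, b) \<in> G - {(i, a)}\<close> by auto
    ultimately show ?thesis by linarith
  qed
  have "k = card (G - {(i, a)})" using Suc a by simp
  then obtain B where B: "block_list B" "cells B = G - {(i, a)}"
    using Suc.hyps(1)[of "G - {(i, a)}"] Suc.prems by auto
  show ?case
  proof (cases B)
    case Nil
    then show ?thesis using B a
      by (intro exI[of _ "[(a, {i})]"]) (auto simp: block_list_Cons)
  next
    case (Cons p B')
    obtain b T where p: "p = (b, T)" by force
    show ?thesis
    \<comment> \<open>The removed cell joins the first block if that block has the same letter, and
      otherwise opens a block of its own. Neighbouring letters stay distinct either way.\<close>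
    proof (cases "a = b")
      case True
      then have *: "cells B' \<subseteq> G - {(i, a)}" "T \<times> {a} \<union> cells B' = G - {(i, a)}"
        using B Cons p by auto
      have "block_list ((a, insert i T) # B')"
        using B(1) True Cons p subsetD[OF *(1)] min by (auto simp: block_list_Cons)
      moreover have "cells ((a, insert i T) # B') = G" using *(2) a(1) by auto
      ultimately show ?thesis by blast
    next
      case False
      then show ?thesis using B min a Cons p
        by (intro exI[of _ "(a, {i}) # B"]) (auto simp: block_list_Cons)
    qed
  qed
qed

text \<open>A cell \<open>(i, a)\<close> of a later block \<open>a\<close> is separated from the first block by a cell of another
  letter, lexicographically strictly in between.\<close>

lemma first_block_subset:
  assumes "block_list ((a, T) # B)" "block_list ((a, U) # C)"
    and eq: "cells ((a, T) # B) = cells ((a, U) # C)"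
  shows "T \<subseteq> U"
proof (rule ccontr)
  assume "\<not> T \<subseteq> U"
  then obtain i where i: "i \<in> T" "i \<notin> U" by auto
  then have iC: "(i, a) \<in> cells C" using eq by auto
  then obtain c V C' where C: "C = (c, V) # C'" by (cases C) auto
  note C_list = block_list_ConsD(1)[OF assms(2), unfolded C]
  have V: "c \<noteq> a" "V \<noteq> {}"
    using block_list_ConsD(4)[OF assms(2)] block_list_ConsD(3)[OF C_list] C by auto
  then obtain j where j: "j \<in> V" by blast
  \<comment> \<open>As \<open>c \<noteq> a\<close>, the cell \<open>(j, c)\<close> lies in the tail
    \<open>B\<close> and so comes after \<open>(i, a)\<close>; inside \<open>C\<close> it comes
    before \<open>(i, a)\<close>.\<close>
  then have "(j, c) \<in> cells ((a, T) # B)" using C unfolding eq by simp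
  then have "(j, c) \<in> cells B" using V by simp
  then have 1: "i < j \<or> i = j \<and> a < c" using block_list_ConsD(5)[OF assms(1) i(1)] by blast
  have "(i, a) \<in> cells C'" using iC C V by simp
  then have "j < i \<or> j = i \<and> c < a" using block_list_ConsD(5)[OF C_list j] by blast
  with 1 show False by linarith
qed

text \<open>All cells of the tail come after those of the first block, so \<open>(Min T, a)\<close>
  is the least cell. This recovers the first letter from the set of cells alone.\<close>

lemma block_list_Min:
  assumes "block_list ((a, T) # B)" "(j, d) \<in> cells ((a, T) # B)"
  shows "Min T < j \<or> Min T = j \<and> a \<le> d"
proof (cases "(j, d) \<in> cells B")
  case True
  have "Min T \<in> T" using block_list_ConsD(2,3)[OF assms(1)] by simp
  from block_list_ConsD(5)[OF assms(1) this True] show ?thesis by linarith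
next
  case False
  then have "j \<in> T" "d = a" using assms(2) by auto
  moreover have "Min T \<le> j" using block_list_ConsD(2)[OF assms(1)] calculation(1) by simp
  ultimately show ?thesis by auto
qed

text \<open>The least cell determines the first letter, \<open>first_block_subset\<close> used both
  ways determines the first label set, and the remaining cells are left to the induction.\<close>

lemma block_list_unique:
  assumes "block_list B" "block_list C" "cells B = cells C"
  shows "B = C"
  using assms
proof (induction B arbitrary: C)
  case Nil
  then show ?case by (cases C) (auto simp: block_list_Cons)
next
  case (Cons p B)
  obtain a T where p: "p = (a, T)" by force
  have "C \<noteq> []" using Cons.prems p by (auto simp: block_list_Cons)
  then obtain c U C' where C: "C = (c, U) # C'" by (cases C) auto
  note b = Cons.prems[unfolded p C]
  have T: "finite T" "T \<noteq> {}" and U: "finite U" "U \<noteq> {}" 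
    using block_list_ConsD(2,3) b by blast+
  have T': "Min T < j \<or> Min T = j \<and> a \<le> d" if "(j, d) \<in> cells ((a, T) # B)" for j d
    using block_list_Min[OF b(1) that] .
  have U': "Min U < j \<or> Min U = j \<and> c \<le> d" if "(j, d) \<in> cells ((c, U) # C')" for j d
    using block_list_Min[OF b(2) that] .
  have "(Min T, a) \<in> cells ((a, T) # B)" "(Min U, c) \<in> cells ((c, U) # C')"
    using Min_in[OF T] Min_in[OF U] by simp_all
  \<comment> \<open>Each least cell also belongs to the other list, so by antisymmetry the two
    coincide.\<close>
  then have "(Min T, a) \<in> cells ((c, U) # C')" "(Min U, c) \<in> cells ((a, T) # B)"
    unfolding b(3) by blast+
  then have ac: "a = c" using T'[of "Min U" c] U'[of "Min T" a] by linarith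
  note b' = b[folded ac]
  have TU: "T = U"
    using first_block_subset[OF b'] first_block_subset[OF b'(2,1) b'(3)[symmetric]] by blast
  \<comment> \<open>The first block shares no cell with either tail and can be cancelled.\<close>
  have "T \<times> {a} \<inter> cells B = {}" "T \<times> {a} \<inter> cells C' = {}"
    using block_list_ConsD(5)[OF b'(1)] block_list_ConsD(5)[OF b'(2)] TU by blast+
  moreover have "T \<times> {a} \<union> cells B = T \<times> {a} \<union> cells C'" using b'(3) TU by simp
  ultimately have "cells B = cells C'" by blast
  then have "B = C'" using Cons.IH block_list_ConsD(1) b by blast
  then show ?case using p C ac TU by simp
qed

section \<open>Exponents and descents of a block list\<close>

text \<open>Blocks sharing the label \<open>i\<close> have strictly increasing letters, so among
  them the letter identifies the block. Exponents counted by position in the list thus agree with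
  exponents counted by letter.\<close>

lemma card_blocks_containing:
  assumes "block_list B"
  shows "card {j. j < length B \<and> i \<in> snd (B ! j)} = card {a. (i, a) \<in> cells B}"
proof (rule bij_betw_same_card[where f = "\<lambda>j. fst (B ! j)"], rule bij_betw_imageI)
  have less: "fst (B ! j) < fst (B ! k)"
    if "j < k" "k < length B" "i \<in> snd (B ! j)" "i \<in> snd (B ! k)" for j k
  proof -
    have "precedes (B ! j) (B ! k)"
      using assms that sorted_wrt_nth_less[of precedes B j k] by (simp add: block_list_def)
    then show ?thesis using that(3,4) by (auto simp: precedes_def)
  qed
  show "inj_on (\<lambda>j. fst (B ! j)) {j. j < length B \<and> i \<in> snd (B ! j)}"
  proof (rule linorder_inj_onI)
    fix j k
    assume "j < k" "j \<in> {j. j < length B \<and> i \<in> snd (B ! j)}"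
      "k \<in> {j. j < length B \<and> i \<in> snd (B ! j)}"
    then show "fst (B ! j) \<noteq> fst (B ! k)" using less[of j k] by simp
  qed auto
  have "(i, a) \<in> cells B \<longleftrightarrow> (\<exists>j<length B. i \<in> snd (B ! j) \<and> a = fst (B ! j))" for a
  proof -
    have "(i, a) \<in> cells B \<longleftrightarrow> (\<exists>p\<in>set B. fst p = a \<and> i \<in> snd p)"
      by (force simp: cells_def)
    also have "\<dots> \<longleftrightarrow> (\<exists>j<length B. i \<in> snd (B ! j) \<and> a = fst (B ! j))"
      unfolding set_conv_nth by blast
    finally show ?thesis .
  qed
  then show "(\<lambda>j. fst (B ! j)) ` {j. j < length B \<and> i \<in> snd (B ! j)} = {a. (i, a) \<in> cells B}"
    by blast
qed

lemma finite_cells: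
  assumes "block_list B"
  shows "finite (cells B)"
proof (rule finite_subset)
  show "cells B \<subseteq> (\<Union>p\<in>set B. snd p) \<times> fst ` set B" unfolding cells_def by force
  show "finite ((\<Union>p\<in>set B. snd p) \<times> fst ` set B)"
    using assms by (simp add: block_list_def)
qed

text \<open>Given the word, the admissible label sets depend only on its descents: by transitivity
  consecutive blocks suffice, and consecutive letters differ. The right-hand side is the condition
  for a chain.\<close>

lemma block_list_iff_Des:
  assumes "distinct_adj (map fst B)" "\<And>p. p \<in> set B \<Longrightarrow> finite (snd p) \<and> snd p \<noteq> {}"
  shows "block_list B \<longleftrightarrow>
    (\<forall>j. Suc j < length B \<longrightarrow>
      (Suc j \<notin> Des (map fst B) \<longrightarrow> set_le (snd (B ! j)) (snd (B ! Suc j))) \<and>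
      (Suc j \<in> Des (map fst B) \<longrightarrow> set_less (snd (B ! j)) (snd (B ! Suc j))))"
proof -
  have "block_list B \<longleftrightarrow> sorted_wrt precedes B"
    using assms by (auto simp: block_list_def)
  also have "\<dots> \<longleftrightarrow> successively precedes B"
    \<comment> \<open>The strong form asks for transitivity only among members of the list, whose
      label sets are nonempty.\<close>
    by (rule successively_iff_sorted_wrt_strong[symmetric])
       (use assms(2) precedes_trans in blast)
  also have "\<dots> \<longleftrightarrow> (\<forall>j. Suc j < length B \<longrightarrow> precedes (B ! j) (B ! Suc j))"
    by (rule successively_conv_nth)
  also have "\<dots> \<longleftrightarrow> (\<forall>j. Suc j < length B \<longrightarrow>
      (Suc j \<notin> Des (map fst B) \<longrightarrow> set_le (snd (B ! j)) (snd (B ! Suc j))) \<and>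
      (Suc j \<in> Des (map fst B) \<longrightarrow> set_less (snd (B ! j)) (snd (B ! Suc j))))"
  proof (intro iff_allI imp_cong refl)
    fix j assume j: "Suc j < length B"
    then have "fst (B ! j) \<noteq> fst (B ! Suc j)"
      using distinct_adj_nth[OF assms(1), of j] by simp
    then have "precedes (B ! j) (B ! Suc j) \<longleftrightarrow>
        (fst (B ! j) < fst (B ! Suc j) \<longrightarrow> set_le (snd (B ! j)) (snd (B ! Suc j))) \<and>
        (fst (B ! Suc j) < fst (B ! j) \<longrightarrow> set_less (snd (B ! j)) (snd (B ! Suc j)))"
      using precedes_iff[of "snd (B ! j)" "snd (B ! Suc j)" "fst (B ! j)" "fst (B ! Suc j)"]
        assms(2)[of "B ! j"] assms(2)[of "B ! Suc j"] j by simp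
    \<comment> \<open>Positions in \<open>Des\<close> count from 1 and list indices from 0, so
      position \<open>Suc j\<close> compares the entries \<open>j\<close> and
      \<open>Suc j\<close>.\<close>
    moreover have "Suc j \<in> Des (map fst B) \<longleftrightarrow> fst (B ! Suc j) < fst (B ! j)"
      using j by (simp add: Des_def)
    moreover have "\<not> fst (B ! Suc j) < fst (B ! j) \<longleftrightarrow> fst (B ! j) < fst (B ! Suc j)"
      using \<open>fst (B ! j) \<noteq> fst (B ! Suc j)\<close> by linarith
    ultimately show "precedes (B ! j) (B ! Suc j) \<longleftrightarrow>
      (Suc j \<notin> Des (map fst B) \<longrightarrow> set_le (snd (B ! j)) (snd (B ! Suc j))) \<and>
      (Suc j \<in> Des (map fst B) \<longrightarrow> set_less (snd (B ! j)) (snd (B ! Suc j)))"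
      by simp
  qed
  finally show ?thesis .
qed

section \<open>Compositions and descents\<close>

text \<open>Only proper nonempty prefixes contribute, so the former total enters when a part is
  appended. The inductions below therefore peel off the last part.\<close>

lemma comp_to_set_snoc:
  "comp_to_set (\<alpha> @ [a]) = (if \<alpha> = [] then {} else insert (sum_list \<alpha>) (comp_to_set \<alpha>))"
proof (cases "\<alpha> = []")
  case False
  then have "1 \<le> length \<alpha>" by (simp add: Suc_le_eq)
  then have "{1..<length (\<alpha> @ [a])} = insert (length \<alpha>) {1..<length \<alpha>}" by auto
  then show ?thesis using False by (simp add: comp_to_set_def)
qed (simp add: comp_to_set_def)

lemma comp_to_set_bounds: "\<alpha> \<in> compositions m \<Longrightarrow> comp_to_set \<alpha> \<subseteq> {1..<m}"
proof (induction \<alpha> arbitrary: m rule: rev_induct)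
  case (snoc a \<alpha>)
  then have "\<alpha> \<in> compositions (sum_list \<alpha>)" "m = sum_list \<alpha> + a" "a > 0"
    by (auto simp: compositions_def)
  moreover have "sum_list \<alpha> > 0" if "\<alpha> \<noteq> []"
    using that \<open>\<alpha> \<in> compositions (sum_list \<alpha>)\<close> by (cases \<alpha>) (auto simp: compositions_def)
  moreover have "comp_to_set \<alpha> \<subseteq> {1..<sum_list \<alpha>}"
    using snoc.IH calculation(1) .
  ultimately show ?case by (auto simp: comp_to_set_snoc Suc_le_eq intro: less_le_trans)
qed (simp add: comp_to_set_def)

text \<open>The total of all parts but the last is the largest element of the set. It fixes the last
  part, and removing it leaves the set of the shorter composition.\<close>

lemma inj_on_comp_to_set: "inj_on comp_to_set (compositions m)"
proof (rule inj_onI)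
  fix \<alpha> \<beta>
  assume "\<alpha> \<in> compositions m" "\<beta> \<in> compositions m" "comp_to_set \<alpha> = comp_to_set \<beta>"
  then show "\<alpha> = \<beta>"
  proof (induction \<alpha> arbitrary: m \<beta> rule: rev_induct)
    case Nil
    then show ?case by (cases \<beta>) (auto simp: compositions_def)
  next
    case (snoc a \<alpha>)
    have "\<beta> \<noteq> []" using snoc.prems by (auto simp: compositions_def)
    then obtain \<gamma> b where \<beta>: "\<beta> = \<gamma> @ [b]" by (metis rev_exhaust)
    have comp: "\<alpha> \<in> compositions (sum_list \<alpha>)" "\<gamma> \<in> compositions (sum_list \<gamma>)"
      using snoc.prems \<beta> by (auto simp: compositions_def)
    note bounds = this[THEN comp_to_set_bounds]
    have m: "sum_list \<alpha> + a = m" "sum_list \<gamma> + b = m"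
      using snoc.prems \<beta> by (auto simp: compositions_def)
    show ?case
    proof (cases "\<alpha> = [] \<or> \<gamma> = []")
      case True
      then have "\<alpha> = []" "\<gamma> = []"
        using snoc.prems(3) \<beta> by (auto simp: comp_to_set_snoc split: if_splits)
      then show ?thesis using m \<beta> by simp
    next
      case False
      then have eq: "insert (sum_list \<alpha>) (comp_to_set \<alpha>) = insert (sum_list \<gamma>) (comp_to_set \<gamma>)"
        using snoc.prems(3) \<beta> by (simp add: comp_to_set_snoc)
      then have s: "sum_list \<alpha> = sum_list \<gamma>"
        using bounds by (metis atLeastLessThan_iff insertE insertI1 less_asym subsetD)
      have "sum_list \<alpha> \<notin> comp_to_set \<alpha>" "sum_list \<gamma> \<notin> comp_to_set \<gamma>"
        using bounds by auto
      then have "comp_to_set \<alpha> = comp_to_set \<gamma>" using eq s by (simp add: insert_ident)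
      then have "\<alpha> = \<gamma>" using snoc.IH[of "sum_list \<alpha>" \<gamma>] comp s by simp
      then show ?thesis using m \<beta> by simp
    qed
  qed
qed

text \<open>The largest element \<open>d\<close> of \<open>D\<close> becomes the total of all parts
  but the last, which is \<open>m - d\<close>; the rest is a composition of
  \<open>d < m\<close>.\<close>

lemma comp_to_set_surj: "D \<subseteq> {1..<m} \<Longrightarrow> \<exists>\<alpha>\<in>compositions m. comp_to_set \<alpha> = D"
proof (induction m arbitrary: D rule: less_induct)
  case (less m)
  show ?case
  proof (cases "D = {}")
    case True
    then show ?thesis
      \<comment> \<open>Parts are positive, so for \<open>m = 0\<close> the witness has to be the
        empty list instead of \<open>[m]\<close>.\<close>
      by (intro bexI[of _ "if m = 0 then [] else [m]"]) (auto simp: comp_to_set_def compositions_def)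
  next
    case False
    have "finite D" using less.prems finite_subset by blast
    define d where "d = Max D"
    have d: "d \<in> D" "\<And>x. x \<in> D \<Longrightarrow> x \<le> d"
      using \<open>finite D\<close> False by (auto simp: d_def)
    then have "d < m" "0 < d" using less.prems by auto
    have "x \<in> {1..<d}" if "x \<in> D - {d}" for x
      using d(2)[of x] less.prems that by (auto simp: le_less)
    then obtain \<alpha> where \<alpha>: "\<alpha> \<in> compositions d" "comp_to_set \<alpha> = D - {d}"
      using less.IH[of d "D - {d}"] \<open>d < m\<close> by blast
    then have "\<alpha> \<noteq> []" using \<open>0 < d\<close> by (auto simp: compositions_def)
    then show ?thesis using \<alpha> \<open>d < m\<close> d
      by (intro bexI[of _ "\<alpha> @ [m - d]"]) (auto simp: comp_to_set_snoc compositions_def)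
  qed
qed

lemma bij_betw_comp_to_set: "bij_betw comp_to_set (compositions m) (Pow {1..<m})"
proof (rule bij_betw_imageI[OF inj_on_comp_to_set], intro equalityI subsetI)
  fix D assume "D \<in> Pow {1..<m}"
  then obtain \<alpha> where "\<alpha> \<in> compositions m" "comp_to_set \<alpha> = D"
    using comp_to_set_surj[of D m] by blast
  then show "D \<in> comp_to_set ` compositions m" by blast
next
  fix D assume "D \<in> comp_to_set ` compositions m"
  then show "D \<in> Pow {1..<m}" using comp_to_set_bounds by blast
qed

lemma Des_subset: "Des w \<subseteq> {1..<length w}"
  by (auto simp: Des_def)

text \<open>\<open>Des w\<close> lies in the range of \<open>comp_to_set\<close>, where
  \<open>the_inv_into\<close> is a true inverse. Length and descent set of a word can thus be read
  off its composition.\<close>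

lemma word_comp_props:
  shows sum_list_word_comp: "sum_list (word_comp w) = length w"
    and comp_to_set_word_comp: "comp_to_set (word_comp w) = Des w"
proof -
  note bij = bij_betw_comp_to_set[of "length w"]
  have "word_comp w \<in> compositions (length w)"
    unfolding word_comp_def set_to_comp_def
    using the_inv_into_into[OF bij_betw_imp_inj_on[OF bij] _ order.refl] Des_subset[of w]
    by (simp add: bij_betw_imp_surj_on[OF bij])
  then show "sum_list (word_comp w) = length w" by (simp add: compositions_def)
  show "comp_to_set (word_comp w) = Des w"
    unfolding word_comp_def set_to_comp_def
    using f_the_inv_into_f_bij_betw[OF bij] Des_subset[of w] by simp
qed

text \<open>Guarantees that the choice of a permutation in \<open>Ltilde\<close> has a
  witness.\<close>

lemma permutation_with_Des:
  "D \<subseteq> {1..<N} \<Longrightarrow> \<exists>w\<in>permutations_of_set {1..N}. Des w = D"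
proof (induction N arbitrary: D)
  case 0
  then show ?case by (auto simp: Des_def)
next
  case (Suc N)
  obtain w where w: "w \<in> permutations_of_set {1..N}" "Des w = D \<inter> {1..<N}"
    using Suc.IH[of "D \<inter> {1..<N}"] by auto
  then have set: "set w = {1..N}" "distinct w" by (auto simp: permutations_of_set_def)
  then have len: "length w = N" using distinct_card by force
  \<comment> \<open>Appending a new minimum creates a descent at \<open>N\<close>, appending a new
    maximum an ascent. Shifting by \<open>Suc\<close> makes room for the letter 1 and keeps the
    earlier descents.\<close>
  define v where "v = (if N \<in> D then map Suc w @ [1] else w @ [Suc N])"
  have "set v = {1..Suc N}" "distinct v"
    using set by (auto simp: v_def distinct_map image_Suc_atLeastAtMost)
  moreover have "Des v = D"
  proof -
    have range: "1 \<le> w ! k \<and> w ! k \<le> N" if "k < N" for k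
      using nth_mem[of k w] that set len by simp
    have "i \<in> Des v \<longleftrightarrow> i \<in> D" for i
    proof -
      consider "1 \<le> i" "i < N" | "1 \<le> i" "i = N" | "\<not> (1 \<le> i \<and> i \<le> N)" by linarith
      then show ?thesis
      proof cases
        case 1
        then have "i \<in> Des v \<longleftrightarrow> i \<in> Des w" by (auto simp: v_def Des_def len nth_append)
        then show ?thesis using 1 w by simp
      next
        case 2
        then show ?thesis using range[of "i - 1"] by (auto simp: v_def Des_def len nth_append)
      next
        case 3
        then show ?thesis using Suc.prems by (auto simp: v_def Des_def len)
      qed
    qed
    then show ?thesis by blast
  qed
  ultimately show ?case by (auto simp: permutations_of_set_def)
qed

section \<open>Set-valued partitions as block lists\<close>

text \<open>Induction on the size of the interval from \<open>x\<close> to \<open>y\<close>: a pair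
  that is not a cover has an element \<open>u\<close> strictly between. Transitivity is assumed only
  through elements of \<open>P\<close>, which suits \<open>precedes\<close>.\<close>

lemma partial_order_from_covers:
  assumes "finite P" "partial_order_on P r"
    and covers: "\<And>x y. covers P r x y \<Longrightarrow> Q x y"
    and trans: "\<And>x y z. y \<in> P \<Longrightarrow> Q x y \<Longrightarrow> Q y z \<Longrightarrow> Q x z"
    and "x \<in> P" "y \<in> P" "(x, y) \<in> r" "x \<noteq> y"
  shows "Q x y"
  using assms(5-)
proof (induction "card {u \<in> P. (x, u) \<in> r \<and> (u, y) \<in> r}" arbitrary: x y rule: less_induct)
  case less
  show ?case
  proof (cases "covers P r x y")
    case False
    have refl: "(v, v) \<in> r" if "v \<in> P" for v
      using assms(2) that by (auto simp: partial_order_on_def preorder_on_def refl_on_def)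
    have tr: "(u, w) \<in> r" if "(u, v) \<in> r" "(v, w) \<in> r" for u v w
      using assms(2) that by (auto simp: partial_order_on_def preorder_on_def intro: transD)
    have antisym: "u = v" if "(u, v) \<in> r" "(v, u) \<in> r" for u v
      using assms(2) that by (auto simp: partial_order_on_def dest: antisymD)
    obtain u where u: "u \<in> P" "(x, u) \<in> r" "x \<noteq> u" "(u, y) \<in> r" "u \<noteq> y"
      using False less.prems unfolding covers_def by blast
    define I where "I = (\<lambda>x y. {u \<in> P. (x, u) \<in> r \<and> (u, y) \<in> r})"
    have fin: "finite (I x y)" using assms(1) by (simp add: I_def)
    have "I x u \<subseteq> I x y" "I u y \<subseteq> I x y" unfolding I_def using u tr by blast+
    \<comment> \<open>By antisymmetry the interval up to \<open>u\<close> misses \<open>y\<close>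
      and the one from \<open>u\<close> misses \<open>x\<close>, so both are strictly
      smaller.\<close>
    moreover have "y \<in> I x y - I x u" "x \<in> I x y - I u y"
      unfolding I_def using u less.prems refl antisym by blast+
    ultimately have "card (I x u) < card (I x y)" "card (I u y) < card (I x y)"
      using fin by (blast intro: psubset_card_mono)+
    then have "Q x u" "Q u y" using less.hyps less.prems u unfolding I_def by blast+
    then show ?thesis using trans u(1) by blast
  qed (rule covers)
qed

text \<open>Injectivity of \<open>\<theta>\<close> turns the condition on covers into
  \<open>precedes\<close>, and transitivity spreads it to all comparable pairs.\<close>

lemma set_valued_partitions_iff:
  assumes "finite P" "partial_order_on P r" "inj_on \<theta> P"
  shows "\<sigma> \<in> set_valued_partitions P r \<theta> \<longleftrightarrow>
    \<sigma> \<in> P \<rightarrow>\<^sub>E {a. finite a \<and> a \<noteq> {} \<and> a \<subseteq> {1..}} \<and>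
    (\<forall>x\<in>P. \<forall>y\<in>P. (x, y) \<in> r \<and> x \<noteq> y \<longrightarrow> precedes (\<theta> x, \<sigma> x) (\<theta> y, \<sigma> y))"
proof (cases "\<sigma> \<in> P \<rightarrow>\<^sub>E {a. finite a \<and> a \<noteq> {} \<and> a \<subseteq> {1..}}")
  case True
  then have val: "finite (\<sigma> x)" "\<sigma> x \<noteq> {}" if "x \<in> P" for x
    using PiE_mem[OF True that] by simp_all
  have iff: "precedes (\<theta> x, \<sigma> x) (\<theta> y, \<sigma> y) \<longleftrightarrow>
      (\<theta> x < \<theta> y \<longrightarrow> set_le (\<sigma> x) (\<sigma> y)) \<and> (\<theta> y < \<theta> x \<longrightarrow> set_less (\<sigma> x) (\<sigma> y))"
    if "x \<in> P" "y \<in> P" "x \<noteq> y" for x y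
    using precedes_iff[of "\<sigma> x" "\<sigma> y" "\<theta> x" "\<theta> y"] val that inj_onD[OF assms(3), of x y] by blast
  have "\<sigma> \<in> set_valued_partitions P r \<theta> \<longleftrightarrow>
      (\<forall>x y. covers P r x y \<longrightarrow> precedes (\<theta> x, \<sigma> x) (\<theta> y, \<sigma> y))" (is "_ \<longleftrightarrow> ?C")
    unfolding set_valued_partitions_def covers_def using True iff by auto
  also have "?C \<longleftrightarrow>
      (\<forall>x\<in>P. \<forall>y\<in>P. (x, y) \<in> r \<and> x \<noteq> y \<longrightarrow> precedes (\<theta> x, \<sigma> x) (\<theta> y, \<sigma> y))" (is "_ \<longleftrightarrow> ?R")
  proof
    assume C: ?C
    show ?R
    proof (intro ballI impI, elim conjE)
      fix x y assume "x \<in> P" "y \<in> P" "(x, y) \<in> r" "x \<noteq> y"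
      then show "precedes (\<theta> x, \<sigma> x) (\<theta> y, \<sigma> y)"
      proof (rule partial_order_from_covers[OF assms(1,2),
            where Q = "\<lambda>x y. precedes (\<theta> x, \<sigma> x) (\<theta> y, \<sigma> y)", rotated 2])
        show "precedes (\<theta> x, \<sigma> x) (\<theta> z, \<sigma> z)"
          if "y \<in> P" "precedes (\<theta> x, \<sigma> x) (\<theta> y, \<sigma> y)" "precedes (\<theta> y, \<sigma> y) (\<theta> z, \<sigma> z)" for x y z
          using precedes_trans[OF that(2,3)] val(2)[OF that(1)] by simp
      qed (use C in blast)
    qed
  next
    assume ?R
    then show ?C unfolding covers_def by blast
  qed
  finally show ?thesis using True by blast
qed (simp add: set_valued_partitions_def)

section \<open>Words of linear multi-extensions\<close>

lemma length_ext_word [simp]: "length (ext_word P \<theta> N e) = N"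
  by (simp add: ext_word_def)

lemma nth_ext_word: "j < N \<Longrightarrow> ext_word P \<theta> N e ! j = \<theta> (THE x. x \<in> P \<and> Suc j \<in> e x)"
  unfolding ext_word_def by (subst nth_map) (simp_all del: upt_Suc)

text \<open>Since \<open>\<theta>\<close> is injective, the extension can be recovered from its
  word. Nonempty values mean that every letter occurs, condition (3) that neighbours differ, and
  condition (1) becomes the order of occurrences.\<close>

lemma multi_Jordan_Hoelder_iff:
  assumes "inj_on \<theta> P"
  shows "w \<in> multi_Jordan_Hoelder P r \<theta> N \<longleftrightarrow>
    length w = N \<and> set w = \<theta> ` P \<and> distinct_adj w \<and>
    (\<forall>x\<in>P. \<forall>y\<in>P. (x, y) \<in> r \<and> x \<noteq> y \<longrightarrow>
      (\<forall>j<N. \<forall>k<N. w ! j = \<theta> x \<longrightarrow> w ! k = \<theta> y \<longrightarrow> j < k))" (is "_ \<longleftrightarrow> ?R")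
proof
  assume "w \<in> multi_Jordan_Hoelder P r \<theta> N"
  then obtain e where e: "e \<in> linear_multi_extensions P r N" and w: "w = ext_word P \<theta> N e"
    by (auto simp: multi_Jordan_Hoelder_def)
  have len: "length w = N" by (simp add: w)
  note e_conj = e[unfolded linear_multi_extensions_def mem_Collect_eq]
  have e_sub: "e x \<noteq> {}" "e x \<subseteq> {1..N}" if "x \<in> P" for x
    using PiE_mem[OF conjunct1[OF e_conj] that] by simp_all
  have e_less: "set_less (e x) (e y)" if "x \<in> P" "y \<in> P" "(x, y) \<in> r" "x \<noteq> y" for x y
    using conjunct1[OF conjunct2[OF e_conj]] that by simp
  have e_ex1: "\<exists>!x. x \<in> P \<and> i \<in> e x" if "i \<in> {1..N}" for i
    using conjunct1[OF conjunct2[OF conjunct2[OF e_conj]]] that by (rule bspec)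
  have e_adj: "\<not> (i \<in> e x \<and> i + 1 \<in> e x)" if "x \<in> P" for x i
    using conjunct2[OF conjunct2[OF conjunct2[OF e_conj]]] that by simp
  have letter: "\<exists>x\<in>P. Suc j \<in> e x \<and> w ! j = \<theta> x" if "j < N" for j
  proof -
    have "Suc j \<in> {1..N}" using that by auto
    from theI'[OF e_ex1[OF this]] show ?thesis
      using that by (auto simp: w nth_ext_word)
  qed
  \<comment> \<open>Position \<open>Suc j\<close> belongs to a single element of \<open>P\<close>,
    and injectivity of \<open>\<theta>\<close> recovers that element from the letter.\<close>
  have letter_iff: "w ! j = \<theta> x \<longleftrightarrow> Suc j \<in> e x" if jx: "j < N" "x \<in> P" for j x
  proof -
    obtain y where y: "y \<in> P" "Suc j \<in> e y" "w ! j = \<theta> y" using letter jx(1) by blast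
    have "Suc j \<in> {1..N}" using jx by auto
    then have "Suc j \<in> e x \<longleftrightarrow> x = y" using e_ex1[of "Suc j"] y jx by blast
    then show ?thesis using y(1,3) jx(2) assms by (auto dest: inj_onD)
  qed
  have "set w = \<theta> ` P"
  proof (intro equalityI subsetI)
    fix a assume "a \<in> set w"
    then show "a \<in> \<theta> ` P" using letter len by (auto simp: in_set_conv_nth)
  next
    fix a assume "a \<in> \<theta> ` P"
    then obtain x where x: "x \<in> P" "a = \<theta> x" by blast
    then obtain i where "i \<in> e x" "1 \<le> i" "i \<le> N" using e_sub[OF x(1)] by fastforce
    then have "i - 1 < N" "w ! (i - 1) = \<theta> x" using letter_iff[of "i - 1" x] x by auto
    then show "a \<in> set w" using len x nth_mem by metis
  qed
  moreover have "distinct_adj w"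
    unfolding distinct_adj_conv_nth
  proof (intro allI impI)
    fix j assume j: "Suc j < length w"
    then obtain x where x: "x \<in> P" "Suc j \<in> e x" "w ! j = \<theta> x" using letter[of j] len by auto
    then show "w ! j \<noteq> w ! Suc j" using letter_iff[of "Suc j" x] e_adj[of x "Suc j"] j len by auto
  qed
  moreover have "j < k"
    if xy: "x \<in> P" "y \<in> P" "(x, y) \<in> r" "x \<noteq> y" and jk: "j < N" "k < N" "w ! j = \<theta> x" "w ! k = \<theta> y"
    for x y j k
  proof -
    have in_e: "Suc j \<in> e x" "Suc k \<in> e y" using letter_iff xy jk by auto
    have fin: "finite (e x)" "finite (e y)" using e_sub xy finite_subset by blast+
    have "Suc j \<le> Max (e x)" using in_e fin by simp
    also have "\<dots> < Min (e y)" using e_less[OF xy] by (simp add: set_less_def)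
    also have "\<dots> \<le> Suc k" using in_e fin by simp
    finally show ?thesis by simp
  qed
  ultimately show ?R using len by blast
next
  assume R: ?R
  then have len: "length w = N" and set: "set w = \<theta> ` P" and adj: "distinct_adj w"
    by simp_all
  have less: "j < k"
    if "x \<in> P" "y \<in> P" "(x, y) \<in> r" "x \<noteq> y" "j < N" "k < N" "w ! j = \<theta> x" "w ! k = \<theta> y"
    for x y j k
    using conjunct2[OF conjunct2[OF conjunct2[OF R]]] that by simp
  \<comment> \<open>Forced by the word: the positions of the letter \<open>\<theta> x\<close>,
    counted from 1.\<close>
  define e where "e = (\<lambda>x\<in>P. {i \<in> {1..N}. w ! (i - 1) = \<theta> x})"
  have e: "i \<in> e x \<longleftrightarrow> 1 \<le> i \<and> i \<le> N \<and> w ! (i - 1) = \<theta> x" if "x \<in> P" for i x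
    using that by (simp add: e_def)
  have ne: "e x \<noteq> {}" if x: "x \<in> P" for x
  proof -
    have "\<theta> x \<in> set w" using x set by simp
    then obtain j where "j < N" "w ! j = \<theta> x" using len by (auto simp: in_set_conv_nth)
    then have "Suc j \<in> e x" using e[OF x] by simp
    then show ?thesis by blast
  qed
  have sub: "e x \<subseteq> {1..N}" if "x \<in> P" for x using e[OF that] by auto
  have e_PiE: "e \<in> P \<rightarrow>\<^sub>E {a. a \<noteq> {} \<and> a \<subseteq> {1..N}}"
    using ne sub unfolding e_def by (intro PiE_I) auto
  have e_less: "set_less (e x) (e y)" if xy: "x \<in> P" "y \<in> P" "(x, y) \<in> r" "x \<noteq> y" for x y
  proof -
    have fin: "finite (e x)" "finite (e y)" using sub xy finite_subset by blast+
    have "Max (e x) \<in> e x" "Min (e y) \<in> e y" using fin ne xy by simp_all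
    then have "Max (e x) - 1 < Min (e y) - 1"
      using less[OF xy, of "Max (e x) - 1" "Min (e y) - 1"] e xy by auto
    then show ?thesis by (simp add: set_less_def)
  qed
  have ex1: "\<exists>!x. x \<in> P \<and> i \<in> e x" if i: "i \<in> {1..N}" for i
  proof -
    have "w ! (i - 1) \<in> \<theta> ` P" using set nth_mem[of "i - 1" w] i len by auto
    then obtain x where x: "x \<in> P" "w ! (i - 1) = \<theta> x" by blast
    show ?thesis
      by (rule ex1I[of _ x]) (use x i e inj_onD[OF assms] in auto)
  qed
  have e_adj: "\<not> (i \<in> e x \<and> i + 1 \<in> e x)" if x: "x \<in> P" for x i
  proof
    assume "i \<in> e x \<and> i + 1 \<in> e x"
    then have "1 \<le> i" "i < N" "w ! (i - 1) = w ! i" using e[OF x] by auto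
    then show False using distinct_adj_nth[OF adj, of "i - 1"] len by simp
  qed
  have "e \<in> linear_multi_extensions P r N"
    unfolding linear_multi_extensions_def using e_PiE e_less ex1 e_adj by simp
  moreover have "w = ext_word P \<theta> N e"
  proof (rule nth_equalityI)
    show "length w = length (ext_word P \<theta> N e)" by (simp add: len)
    fix j assume j: "j < length w"
    then have "Suc j \<in> {1..N}" using len by auto
    note the = theI'[OF ex1[OF this]]
    have "ext_word P \<theta> N e ! j = \<theta> (THE x. x \<in> P \<and> Suc j \<in> e x)"
      using j len by (simp add: nth_ext_word)
    also have "\<dots> = w ! j" using the e by auto
    finally show "w ! j = ext_word P \<theta> N e ! j" by simp
  qed
  ultimately show "w \<in> multi_Jordan_Hoelder P r \<theta> N"
    unfolding multi_Jordan_Hoelder_def by blast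
qed

text \<open>\<open>B\<close> lists the cells in lexicographic order, so all cells of
  \<open>x\<close> come before all cells of \<open>y\<close> exactly when every block with letter
  \<open>\<theta> x\<close> stands before every block with letter \<open>\<theta> y\<close>.\<close>

lemma set_valued_partition_iff_multi_Jordan_Hoelder:
  assumes "finite P" "partial_order_on P r" "inj_on \<theta> P"
    and B: "block_list B" "cells B = {(i, \<theta> x) |i x. x \<in> P \<and> i \<in> \<sigma> x}"
    and \<sigma>: "\<sigma> \<in> P \<rightarrow>\<^sub>E {a. finite a \<and> a \<noteq> {} \<and> a \<subseteq> {1..}}"
  shows "\<sigma> \<in> set_valued_partitions P r \<theta> \<longleftrightarrow>
    map fst B \<in> multi_Jordan_Hoelder P r \<theta> (length B)"
proof -
  have \<sigma>_ne: "\<sigma> x \<noteq> {}" if "x \<in> P" for x using PiE_mem[OF \<sigma> that] by simp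
  have set: "set (map fst B) = \<theta> ` P"
  proof -
    have "snd ` cells B = \<theta> ` P" using \<sigma>_ne by (force simp: B(2) image_iff)
    then show ?thesis using snd_image_cells[OF B(1)] by simp
  qed
  have block_ne: "snd (B ! j) \<noteq> {}" if "j < length B" for j
    using B(1) that by (simp add: block_list_def)
  have in_cells: "(i, fst (B ! j)) \<in> cells B" if "j < length B" "i \<in> snd (B ! j)" for i j
    unfolding cells_def using that nth_mem[of j B] by (auto intro!: exI[of _ "snd (B ! j)"])
  have in_\<sigma>: "i \<in> \<sigma> x"
    if jx: "j < length B" "fst (B ! j) = \<theta> x" "x \<in> P" "i \<in> snd (B ! j)" for i j x
  proof -
    obtain y where "y \<in> P" "i \<in> \<sigma> y" "\<theta> x = \<theta> y" using in_cells[OF jx(1,4)] B(2) jx(2) by auto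
    then show ?thesis using inj_onD[OF assms(3)] jx(3) by metis
  qed
  have block: "\<exists>j<length B. fst (B ! j) = \<theta> x \<and> i \<in> snd (B ! j)" if "x \<in> P" "i \<in> \<sigma> x" for i x
  proof -
    have "(i, \<theta> x) \<in> cells B" using that B(2) by blast
    then obtain T where "(\<theta> x, T) \<in> set B" "i \<in> T" unfolding cells_def by blast
    then show ?thesis unfolding in_set_conv_nth by (metis fst_conv snd_conv)
  qed
  have sorted: "precedes (B ! j) (B ! k)" if "j < k" "k < length B" for j k
    using B(1) that sorted_wrt_nth_less unfolding block_list_def by blast
  have "precedes (\<theta> x, \<sigma> x) (\<theta> y, \<sigma> y) \<longleftrightarrow>
      (\<forall>j<length B. \<forall>k<length B. map fst B ! j = \<theta> x \<longrightarrow> map fst B ! k = \<theta> y \<longrightarrow> j < k)"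
    if xy: "x \<in> P" "y \<in> P" "x \<noteq> y" for x y
  proof (intro iffI allI impI)
    fix j k
    assume prec: "precedes (\<theta> x, \<sigma> x) (\<theta> y, \<sigma> y)"
      and jk: "j < length B" "k < length B" "map fst B ! j = \<theta> x" "map fst B ! k = \<theta> y"
    then have fst: "fst (B ! j) = \<theta> x" "fst (B ! k) = \<theta> y" by simp_all
    obtain i i' where i: "i \<in> snd (B ! j)" "i' \<in> snd (B ! k)" using block_ne jk by blast
    then have "i < i' \<or> i = i' \<and> \<theta> x < \<theta> y"
      using prec in_\<sigma>[OF jk(1) fst(1) xy(1)] in_\<sigma>[OF jk(2) fst(2) xy(2)]
      unfolding precedes_def by auto
    \<comment> \<open>If \<open>k < j\<close>, sortedness of \<open>B\<close> yields the opposite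
      comparison of the same two cells.\<close>
    moreover have "i' < i \<or> i' = i \<and> \<theta> y < \<theta> x" if "k < j"
      using sorted[OF that jk(1)] i fst unfolding precedes_def by auto
    moreover have "j \<noteq> k" using fst inj_onD[OF assms(3) _ xy(1,2)] xy(3) by auto
    ultimately show "j < k" by linarith
  next
    assume pos: "\<forall>j<length B. \<forall>k<length B. map fst B ! j = \<theta> x \<longrightarrow> map fst B ! k = \<theta> y \<longrightarrow> j < k"
    have "i < i' \<or> i = i' \<and> \<theta> x < \<theta> y" if ii': "i \<in> \<sigma> x" "i' \<in> \<sigma> y" for i i'
    proof -
      obtain j where j: "j < length B" "fst (B ! j) = \<theta> x" "i \<in> snd (B ! j)"
        using block[OF xy(1) ii'(1)] by blast
      obtain k where k: "k < length B" "fst (B ! k) = \<theta> y" "i' \<in> snd (B ! k)"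
        using block[OF xy(2) ii'(2)] by blast
      have "j < k" using pos j k by simp
      from sorted[OF this k(1)] show ?thesis using j k unfolding precedes_def by auto
    qed
    then show "precedes (\<theta> x, \<sigma> x) (\<theta> y, \<sigma> y)" unfolding precedes_def by simp
  qed
  \<comment> \<open>The other conditions on the word hold for any \<open>\<sigma>\<close> with
    nonempty values, so only the order condition had to be compared.\<close>
  moreover have "distinct_adj (map fst B)" using B(1) by (simp add: block_list_def)
  ultimately show ?thesis
    unfolding set_valued_partitions_iff[OF assms(1-3)] multi_Jordan_Hoelder_iff[OF assms(3)]
    using \<sigma> set by auto
qed

section \<open>Counting\<close>

text \<open>The common currency of both sides: with \<open>W = {w}\<close> the fillings count a
  coefficient of \<open>Ltilde (word_comp w)\<close>, with \<open>W\<close> the words of all linear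
  multi-extensions a coefficient of \<open>Ktilde P r \<theta>\<close>.\<close>

definition fillings :: "nat list set \<Rightarrow> (nat \<Rightarrow>\<^sub>0 nat) \<Rightarrow> (nat \<times> nat set) list set" where
  "fillings W m = {B. block_list B \<and> map fst B \<in> W \<and> (\<forall>p\<in>set B. snd p \<subseteq> {1..}) \<and>
     (\<forall>i. card {j. j < length B \<and> i \<in> snd (B ! j)} = Poly_Mapping.lookup m i)}"

section \<open>Chains and the coefficients of multi-fundamental series\<close>

abbreviation chain_order :: "nat \<Rightarrow> nat rel" where
  "chain_order N \<equiv> {(i, j). i \<in> {1..N} \<and> j \<in> {1..N} \<and> i \<le> j}"

lemma covers_chain: "covers {1..N} (chain_order N) s t \<longleftrightarrow> 1 \<le> s \<and> t = Suc s \<and> t \<le> N"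
proof
  assume c: "covers {1..N} (chain_order N) s t"
  then have "1 \<le> s" "s < t" "t \<le> N" by (auto simp: covers_def)
  moreover have "t = Suc s"
  proof (rule ccontr)
    assume "t \<noteq> Suc s"
    then show False using c \<open>s < t\<close> \<open>t \<le> N\<close> unfolding covers_def by (auto dest!: bspec[of _ _ "Suc s"])
  qed
  ultimately show "1 \<le> s \<and> t = Suc s \<and> t \<le> N" by simp
qed (auto simp: covers_def)

text \<open>Covers in the chain are consecutive elements, and the letters of a permutation are
  distinct, so each cover is weak or strict according to \<open>Des v\<close>. The form matches
  \<open>block_list_iff_Des\<close>.\<close>

lemma set_valued_partitions_chain_iff:
  assumes v: "v \<in> permutations_of_set {1..N}"
  shows "\<tau> \<in> set_valued_partitions {1..N} (chain_order N) (\<lambda>i. v ! (i - 1)) \<longleftrightarrow>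
    \<tau> \<in> {1..N} \<rightarrow>\<^sub>E {a. finite a \<and> a \<noteq> {} \<and> a \<subseteq> {1..}} \<and>
    (\<forall>j. Suc j < N \<longrightarrow>
      (Suc j \<notin> Des v \<longrightarrow> set_le (\<tau> (Suc j)) (\<tau> (Suc (Suc j)))) \<and>
      (Suc j \<in> Des v \<longrightarrow> set_less (\<tau> (Suc j)) (\<tau> (Suc (Suc j)))))"
proof -
  have dist: "distinct v" and len: "length v = N"
    using v by (auto simp: permutations_of_set_def dest: distinct_card)
  have "(\<forall>s t. covers {1..N} (chain_order N) s t \<longrightarrow>
      (v ! (s - 1) < v ! (t - 1) \<longrightarrow> set_le (\<tau> s) (\<tau> t)) \<and>
      (v ! (t - 1) < v ! (s - 1) \<longrightarrow> set_less (\<tau> s) (\<tau> t))) \<longleftrightarrow>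
    (\<forall>j. Suc j < N \<longrightarrow>
      (v ! j < v ! Suc j \<longrightarrow> set_le (\<tau> (Suc j)) (\<tau> (Suc (Suc j)))) \<and>
      (v ! Suc j < v ! j \<longrightarrow> set_less (\<tau> (Suc j)) (\<tau> (Suc (Suc j)))))" (is "?L \<longleftrightarrow> ?R")
  proof
    assume L: ?L
    show ?R
    proof (intro allI impI)
      fix j assume "Suc j < N"
      then have "covers {1..N} (chain_order N) (Suc j) (Suc (Suc j))" unfolding covers_chain by simp
      from L[rule_format, OF this] show "(v ! j < v ! Suc j \<longrightarrow> set_le (\<tau> (Suc j)) (\<tau> (Suc (Suc j)))) \<and>
          (v ! Suc j < v ! j \<longrightarrow> set_less (\<tau> (Suc j)) (\<tau> (Suc (Suc j))))"
        by simp
    qed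
  next
    assume R: ?R
    show ?L
    proof (intro allI impI)
      fix s t assume "covers {1..N} (chain_order N) s t"
      then have "1 \<le> s" "t = Suc s" "t \<le> N" unfolding covers_chain by simp_all
      then obtain j where "s = Suc j" "t = Suc (Suc j)" "Suc j < N" by (cases s) auto
      with R show "(v ! (s - 1) < v ! (t - 1) \<longrightarrow> set_le (\<tau> s) (\<tau> t)) \<and>
          (v ! (t - 1) < v ! (s - 1) \<longrightarrow> set_less (\<tau> s) (\<tau> t))"
        by simp
    qed
  qed
  moreover have "(v ! j < v ! Suc j \<longleftrightarrow> Suc j \<notin> Des v) \<and> (v ! Suc j < v ! j \<longleftrightarrow> Suc j \<in> Des v)"
    if "Suc j < N" for j
    using that nth_eq_iff_index_eq[OF dist, of j "Suc j"] len by (auto simp: Des_def)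
  ultimately show ?thesis
    unfolding set_valued_partitions_def by simp
qed

text \<open>The word \<open>w\<close> may repeat letters, while \<open>Ltilde\<close> uses a
  permutation \<open>v\<close>. Both impose the same conditions on the label sets because
  \<open>Des v = Des w\<close>.\<close>

lemma Ltilde_coeff:
  assumes w: "distinct_adj w"
  shows "Ltilde (word_comp w) m = int (card (fillings {w} m))"
proof -
  define N where "N = length w"
  \<comment> \<open>The same choice as in \<open>Ltilde\<close>, so that its definition unfolds to
    \<open>v\<close>.\<close>
  define v where "v = (SOME v. v \<in> permutations_of_set {1..N} \<and> word_comp v = word_comp w)"
  have "\<exists>v. v \<in> permutations_of_set {1..N} \<and> word_comp v = word_comp w"
  proof -
    obtain v where v: "v \<in> permutations_of_set {1..N}" "Des v = Des w"
      using permutation_with_Des[OF Des_subset] N_def by blast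
    then have "length v = N" by (auto simp: permutations_of_set_def dest: distinct_card)
    then show ?thesis using v by (auto simp: word_comp_def N_def)
  qed
  then have v: "v \<in> permutations_of_set {1..N}" "word_comp v = word_comp w"
    unfolding v_def by (rule someI2_ex, blast)+
  have Des: "Des v = Des w" using v(2) comp_to_set_word_comp by metis
  define S where "S = set_valued_partitions {1..N} (chain_order N) (\<lambda>i. v ! (i - 1))"
  have "Ltilde (word_comp w) = Ktilde {1..N} (chain_order N) (\<lambda>i. v ! (i - 1))"
    unfolding Ltilde_def Let_def sum_list_word_comp v_def N_def ..
  then have "Ltilde (word_comp w) m = int (card {\<tau> \<in> S. exponents {1..N} \<tau> = m})"
    unfolding S_def by (simp add: Ktilde_coeff)
  also have "card {\<tau> \<in> S. exponents {1..N} \<tau> = m} = card (fillings {w} m)"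
  proof (rule bij_betw_same_card)
    \<comment> \<open>The values of a chain partition are attached to the letters of
      \<open>w\<close>, not to those of \<open>v\<close>.\<close>
    define F where "F = (\<lambda>\<tau>::nat \<Rightarrow> nat set. map (\<lambda>j. (w ! j, \<tau> (Suc j))) [0..<N])"
    have F: "length (F \<tau>) = N" "map fst (F \<tau>) = w" "\<And>j. j < N \<Longrightarrow> F \<tau> ! j = (w ! j, \<tau> (Suc j))" for \<tau>
      by (auto simp: F_def N_def comp_def map_nth)
    have F_iff: "\<tau> \<in> S \<and> exponents {1..N} \<tau> = m \<longleftrightarrow> F \<tau> \<in> fillings {w} m"
      if \<tau>: "\<tau> \<in> {1..N} \<rightarrow>\<^sub>E {a. finite a \<and> a \<noteq> {} \<and> a \<subseteq> {1..}}" for \<tau>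
    proof -
      have val: "finite (\<tau> (Suc j)) \<and> \<tau> (Suc j) \<noteq> {} \<and> \<tau> (Suc j) \<subseteq> {1..}" if "j < N" for j
        using PiE_mem[OF \<tau>, of "Suc j"] that by simp
      have p: "finite (snd p) \<and> snd p \<noteq> {}" "snd p \<subseteq> {1..}" if p: "p \<in> set (F \<tau>)" for p
      proof -
        obtain j where "j < N" "p = (w ! j, \<tau> (Suc j))" using p by (auto simp: F_def)
        then show "finite (snd p) \<and> snd p \<noteq> {}" "snd p \<subseteq> {1..}" using val[of j] by simp_all
      qed
      have "block_list (F \<tau>) \<longleftrightarrow> (\<forall>j. Suc j < N \<longrightarrow>
          (Suc j \<notin> Des w \<longrightarrow> set_le (\<tau> (Suc j)) (\<tau> (Suc (Suc j)))) \<and>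
          (Suc j \<in> Des w \<longrightarrow> set_less (\<tau> (Suc j)) (\<tau> (Suc (Suc j)))))"
        using block_list_iff_Des[of "F \<tau>"] p(1) w F by simp
      then have "\<tau> \<in> S \<longleftrightarrow> block_list (F \<tau>)"
        unfolding S_def set_valued_partitions_chain_iff[OF v(1)] Des using \<tau> by simp
      moreover have "exponents {1..N} \<tau> = m \<longleftrightarrow>
          (\<forall>i. card {j. j < length (F \<tau>) \<and> i \<in> snd (F \<tau> ! j)} = Poly_Mapping.lookup m i)"
        if "\<tau> \<in> S"
      proof -
        have "card {x \<in> {1..N}. i \<in> \<tau> x} = card {j. j < length (F \<tau>) \<and> i \<in> snd (F \<tau> ! j)}" for i
        proof (rule bij_betw_same_card[symmetric], rule bij_betw_imageI)
          show "inj_on Suc {j. j < length (F \<tau>) \<and> i \<in> snd (F \<tau> ! j)}" by simp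
          have "x \<in> Suc ` {j. j < length (F \<tau>) \<and> i \<in> snd (F \<tau> ! j)} \<longleftrightarrow> x \<in> {1..N} \<and> i \<in> \<tau> x" for x
            by (cases x) (auto simp: F)
          then show "Suc ` {j. j < length (F \<tau>) \<and> i \<in> snd (F \<tau> ! j)} = {x \<in> {1..N}. i \<in> \<tau> x}"
            by blast
        qed
        then show ?thesis
          using lookup_exponents[OF _ that[unfolded S_def]] by (simp add: poly_mapping_eq_iff fun_eq_iff)
      qed
      ultimately show ?thesis
        using p(2) F(2) by (auto simp: fillings_def)
    qed
    show "bij_betw F {\<tau> \<in> S. exponents {1..N} \<tau> = m} (fillings {w} m)"
    proof (rule bij_betw_imageI)
      have S_PiE: "\<tau> \<in> {1..N} \<rightarrow>\<^sub>E {a. finite a \<and> a \<noteq> {} \<and> a \<subseteq> {1..}}" if "\<tau> \<in> S" for \<tau>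
        using that unfolding S_def set_valued_partitions_def by blast
      show "inj_on F {\<tau> \<in> S. exponents {1..N} \<tau> = m}"
      proof (rule inj_onI)
        fix \<tau> \<rho>
        assume "\<tau> \<in> {\<tau> \<in> S. exponents {1..N} \<tau> = m}" "\<rho> \<in> {\<tau> \<in> S. exponents {1..N} \<tau> = m}"
          and eq: "F \<tau> = F \<rho>"
        then have PiE: "\<tau> \<in> {1..N} \<rightarrow>\<^sub>E {a. finite a \<and> a \<noteq> {} \<and> a \<subseteq> {1..}}"
          "\<rho> \<in> {1..N} \<rightarrow>\<^sub>E {a. finite a \<and> a \<noteq> {} \<and> a \<subseteq> {1..}}"
          using S_PiE by blast+
        show "\<tau> = \<rho>"
        proof (rule PiE_ext[OF PiE])
          fix i assume "i \<in> {1..N}"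
          then obtain j where "i = Suc j" "j < N" by (cases i) auto
          then show "\<tau> i = \<rho> i" using F(3)[of j \<tau>] F(3)[of j \<rho>] eq by simp
        qed
      qed
      show "F ` {\<tau> \<in> S. exponents {1..N} \<tau> = m} = fillings {w} m"
      proof (intro equalityI subsetI)
        fix B assume "B \<in> F ` {\<tau> \<in> S. exponents {1..N} \<tau> = m}"
        then show "B \<in> fillings {w} m" using F_iff S_PiE by blast
      next
        fix B assume B: "B \<in> fillings {w} m"
        then have fst: "map fst B = w" by (simp add: fillings_def)
        then have len: "length B = N" unfolding N_def by (metis length_map)
        \<comment> \<open>The inverse of \<open>F\<close> forgets the letters; the restriction makes
          the map extensional.\<close>
        define \<tau> where "\<tau> = (\<lambda>i\<in>{1..N}. snd (B ! (i - 1)))"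
        have val: "snd (B ! j) \<in> {a. finite a \<and> a \<noteq> {} \<and> a \<subseteq> {1..}}" if "j < N" for j
          using B that len nth_mem[of j B] by (simp add: fillings_def block_list_def)
        have "snd (B ! (i - 1)) \<in> {a. finite a \<and> a \<noteq> {} \<and> a \<subseteq> {1..}}" if "i \<in> {1..N}" for i
        proof (rule val)
          show "i - 1 < N" using that by auto
        qed
        then have \<tau>: "\<tau> \<in> {1..N} \<rightarrow>\<^sub>E {a. finite a \<and> a \<noteq> {} \<and> a \<subseteq> {1..}}"
          unfolding \<tau>_def by (intro restrict_PiE_iff[THEN iffD2] ballI)
        have "F \<tau> = B"
        proof (rule nth_equalityI)
          fix j assume "j < length (F \<tau>)"
          then have j: "j < N" by (simp add: F)
          then have "w ! j = fst (B ! j)" using len by (simp flip: fst)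
          then show "F \<tau> ! j = B ! j" using j by (simp add: F \<tau>_def prod_eq_iff)
        qed (simp add: F len)
        then show "B \<in> F ` {\<tau> \<in> S. exponents {1..N} \<tau> = m}" using F_iff[OF \<tau>] B by blast
      qed
    qed
  qed
  finally show ?thesis .
qed

section \<open>Set-valued partitions of a poset and fillings of its words\<close>

text \<open>A partition and its set of cells determine each other since \<open>\<theta>\<close> is
  injective on \<open>P\<close>; a finite set of cells has exactly one block list. Words of all
  lengths are treated together.\<close>

lemma bij_betw_fillings_set_valued_partitions:
  fixes P :: "'a set"
  assumes "finite P" "partial_order_on P r" "inj_on \<theta> P"
  shows "bij_betw (\<lambda>B. \<lambda>x\<in>P. {i. (i, \<theta> x) \<in> cells B})
    (fillings {w. w \<in> multi_Jordan_Hoelder P r \<theta> (length w)} m)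
    {\<sigma> \<in> set_valued_partitions P r \<theta>. exponents P \<sigma> = m}" (is "bij_betw ?f (fillings ?W m) ?S")
proof -
  define G where "G = (\<lambda>\<sigma> :: 'a \<Rightarrow> nat set. {(i, \<theta> x) |i x. x \<in> P \<and> i \<in> \<sigma> x})"
  have G_iff: "(i, \<theta> x) \<in> G \<sigma> \<longleftrightarrow> i \<in> \<sigma> x" if "x \<in> P" for i x \<sigma>
    unfolding G_def using inj_onD[OF assms(3)] that by blast
  \<comment> \<open>One equivalence serves both inclusions: for a given \<open>B\<close> with
    \<open>\<sigma>\<close> read off its cells, and for a given \<open>\<sigma>\<close> with
    \<open>B\<close> from \<open>block_list_exists\<close>.\<close>
  have main: "B \<in> fillings ?W m \<longleftrightarrow> \<sigma> \<in> ?S"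
    if B: "block_list B" "cells B = G \<sigma>"
      and \<sigma>: "\<sigma> \<in> P \<rightarrow>\<^sub>E {a. finite a \<and> a \<noteq> {} \<and> a \<subseteq> {1..}}" for B \<sigma>
  proof -
    have "snd p \<subseteq> {1..}" if "p \<in> set B" for p
    proof
      fix i assume "i \<in> snd p"
      then have "(i, fst p) \<in> G \<sigma>"
        unfolding B(2)[symmetric] cells_def using that by (auto intro!: exI[of _ "snd p"])
      then obtain x where "x \<in> P" "i \<in> \<sigma> x" unfolding G_def by blast
      then show "i \<in> {1..}" using PiE_mem[OF \<sigma>, of x] by blast
    qed
    moreover have "exponents P \<sigma> = m \<longleftrightarrow>
        (\<forall>i. card {j. j < length B \<and> i \<in> snd (B ! j)} = Poly_Mapping.lookup m i)"
      if "\<sigma> \<in> set_valued_partitions P r \<theta>"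
    proof -
      have "card {x \<in> P. i \<in> \<sigma> x} = card {j. j < length B \<and> i \<in> snd (B ! j)}" for i
      proof -
        have "card {x \<in> P. i \<in> \<sigma> x} = card (\<theta> ` {x \<in> P. i \<in> \<sigma> x})"
          by (rule card_image[symmetric], rule inj_on_subset[OF assms(3)]) blast
        also have "\<theta> ` {x \<in> P. i \<in> \<sigma> x} = {a. (i, a) \<in> cells B}"
          unfolding B(2) G_def by blast
        finally show ?thesis using card_blocks_containing[OF B(1)] by simp
      qed
      then show ?thesis
        using lookup_exponents[OF assms(1) that] by (simp add: poly_mapping_eq_iff fun_eq_iff)
    qed
    moreover have "\<sigma> \<in> set_valued_partitions P r \<theta> \<longleftrightarrow> map fst B \<in> ?W"
      using set_valued_partition_iff_multi_Jordan_Hoelder[OF assms B(1) _ \<sigma>] B(2) by (simp add: G_def)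
    ultimately show ?thesis
      unfolding fillings_def using B(1) by blast
  qed
  \<comment> \<open>The letters of \<open>B\<close> are exactly the values of
    \<open>\<theta>\<close> on \<open>P\<close>, so no cell is lost.\<close>
  have f: "G (?f B) = cells B" "?f B \<in> P \<rightarrow>\<^sub>E {a. finite a \<and> a \<noteq> {} \<and> a \<subseteq> {1..}}"
    if B: "B \<in> fillings ?W m" for B
  proof -
    have bl: "block_list B" and pos: "\<And>p. p \<in> set B \<Longrightarrow> snd p \<subseteq> {1..}"
      using B by (simp_all add: fillings_def)
    have "map fst B \<in> ?W" using B by (simp add: fillings_def)
    then have "set (map fst B) = \<theta> ` P" by (simp add: multi_Jordan_Hoelder_iff[OF assms(3)])
    then have snd: "snd ` cells B = \<theta> ` P" using snd_image_cells[OF bl] by simp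
    show "G (?f B) = cells B"
    proof (intro equalityI subsetI)
      fix c assume "c \<in> G (?f B)"
      then show "c \<in> cells B" unfolding G_def by auto
    next
      fix c assume c: "c \<in> cells B"
      then have "snd c \<in> \<theta> ` P" using snd by blast
      then obtain i x where x: "x \<in> P" "c = (i, \<theta> x)" by (cases c) auto
      then have "i \<in> ?f B x" using c by simp
      then show "c \<in> G (?f B)" using x unfolding G_def by blast
    qed
    have "{i. (i, \<theta> x) \<in> cells B} \<in> {a. finite a \<and> a \<noteq> {} \<and> a \<subseteq> {1..}}" if x: "x \<in> P" for x
    proof -
      have "finite (cells B)" using bl by (rule finite_cells)
      moreover have "{i. (i, \<theta> x) \<in> cells B} \<subseteq> fst ` cells B" by force
      ultimately have "finite {i. (i, \<theta> x) \<in> cells B}" using finite_surj by blast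
      moreover have "{i. (i, \<theta> x) \<in> cells B} \<noteq> {}"
      proof -
        have "\<theta> x \<in> snd ` cells B" using snd x by blast
        then show ?thesis by force
      qed
      moreover have "{i. (i, \<theta> x) \<in> cells B} \<subseteq> {1..}"
        using pos unfolding cells_def by fastforce
      ultimately show ?thesis by simp
    qed
    then show "?f B \<in> P \<rightarrow>\<^sub>E {a. finite a \<and> a \<noteq> {} \<and> a \<subseteq> {1..}}"
      by (simp add: restrict_PiE_iff)
  qed
  have bl: "block_list B" if "B \<in> fillings ?W m" for B using that by (simp add: fillings_def)
  show ?thesis
  proof (rule bij_betw_imageI)
    show "inj_on ?f (fillings ?W m)"
    proof (rule inj_onI)
      fix B C assume BC: "B \<in> fillings ?W m" "C \<in> fillings ?W m" and eq: "?f B = ?f C"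
      have "G (?f B) = G (?f C)" using eq by (rule arg_cong)
      then have "cells B = cells C" unfolding f(1)[OF BC(1)] f(1)[OF BC(2)] .
      then show "B = C" by (rule block_list_unique[OF bl[OF BC(1)] bl[OF BC(2)]])
    qed
    show "?f ` fillings ?W m = ?S"
    proof (intro equalityI subsetI)
      fix \<sigma> assume "\<sigma> \<in> ?f ` fillings ?W m"
      then obtain B where B: "B \<in> fillings ?W m" "\<sigma> = ?f B" by blast
      show "\<sigma> \<in> ?S"
        unfolding B(2) using main[OF bl f(1)[symmetric] f(2), OF B(1) B(1) B(1)] B(1) by (rule iffD1)
    next
      fix \<sigma> assume \<sigma>S: "\<sigma> \<in> ?S"
      then have \<sigma>: "\<sigma> \<in> P \<rightarrow>\<^sub>E {a. finite a \<and> a \<noteq> {} \<and> a \<subseteq> {1..}}"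
        unfolding set_valued_partitions_def by blast
      have "finite (\<sigma> x)" if "x \<in> P" for x using PiE_mem[OF \<sigma> that] by simp
      then have "finite ((\<Union>x\<in>P. \<sigma> x) \<times> \<theta> ` P)" using assms(1) by simp
      moreover have "G \<sigma> \<subseteq> (\<Union>x\<in>P. \<sigma> x) \<times> \<theta> ` P" unfolding G_def by blast
      ultimately have "finite (G \<sigma>)" by (rule finite_subset[rotated])
      then obtain B where B: "block_list B" "cells B = G \<sigma>" using block_list_exists by blast
      have eq: "?f B = \<sigma>"
      proof
        fix x show "?f B x = \<sigma> x"
          using PiE_arb[OF \<sigma>, of x] by (cases "x \<in> P") (simp_all add: B(2) G_iff)
      qed
      have "B \<in> fillings ?W m" using main[OF B \<sigma>] \<sigma>S by blast
      from imageI[OF this, of ?f] show "\<sigma> \<in> ?f ` fillings ?W m" unfolding eq .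
    qed
  qed
qed

lemma has_sum_card_fibres:
  assumes "finite X" "f ` X \<subseteq> A"
  shows "((\<lambda>a. int (card {x \<in> X. f x = a})) has_sum int (card X)) A"
proof -
  have "((\<lambda>a. int (card {x \<in> X. f x = a})) has_sum (\<Sum>a\<in>f ` X. int (card {x \<in> X. f x = a}))) (f ` X)"
    using assms(1) by (intro has_sum_finite) simp
  also have "(\<Sum>a\<in>f ` X. int (card {x \<in> X. f x = a})) = int (card X)"
    using sum.image_gen[OF assms(1), of "\<lambda>_. 1::int" f] by simp
  finally show ?thesis
    by (rule has_sum_cong_neutral[THEN iffD1, rotated -1]) (use assms(2) in \<open>auto simp: card_eq_0_iff\<close>)
qed

theorem theorem5p6:
  fixes P :: "'a set" and r :: "'a rel" and \<theta> :: "'a \<Rightarrow> nat" and n :: nat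
  assumes "finite P" and "partial_order_on P r" and "card P = n"
    and "bij_betw \<theta> P {1..n}"
  shows "((\<lambda>N. \<Sum>w\<in>multi_Jordan_Hoelder P r \<theta> N. Ltilde (word_comp w))
           has_sum Ktilde P r \<theta>) {n..}"
  unfolding has_sum_mseries_iff
proof
  fix m
  have inj: "inj_on \<theta> P" using assms(4) by (rule bij_betw_imp_inj_on)
  \<comment> \<open>All block lists contributing to the coefficient at \<open>m\<close>, of every
    length at once.\<close>
  define X where "X = fillings {w. w \<in> multi_Jordan_Hoelder P r \<theta> (length w)} m"
  have bij: "bij_betw (\<lambda>B. \<lambda>x\<in>P. {i. (i, \<theta> x) \<in> cells B}) X
      {\<sigma> \<in> set_valued_partitions P r \<theta>. exponents P \<sigma> = m}"
    unfolding X_def by (rule bij_betw_fillings_set_valued_partitions[OF assms(1,2) inj])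
  have fin: "finite X"
    using bij_betw_finite[OF bij] finite_exponents_fibre[OF assms(1)] by blast
  have K: "Ktilde P r \<theta> m = int (card X)"
    unfolding Ktilde_coeff[OF assms(1)] using bij_betw_same_card[OF bij] by simp
  \<comment> \<open>Each of the \<open>n\<close> distinct letters occurs in the word, so the list
    has at least \<open>n\<close> blocks.\<close>
  have "length ` X \<subseteq> {n..}"
  proof (rule image_subsetI)
    fix B assume "B \<in> X"
    then have "set (map fst B) = \<theta> ` P"
      by (simp add: X_def fillings_def multi_Jordan_Hoelder_iff[OF inj])
    then show "length B \<in> {n..}"
      using card_length[of "map fst B"] card_image[OF inj] assms(3) by simp
  qed
  then have "((\<lambda>N. int (card {B \<in> X. length B = N})) has_sum Ktilde P r \<theta> m) {n..}"
    unfolding K by (rule has_sum_card_fibres[OF fin])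
  moreover have "int (card {B \<in> X. length B = N}) =
      (\<Sum>w\<in>multi_Jordan_Hoelder P r \<theta> N. Ltilde (word_comp w)) m" for N
  proof -
    let ?J = "multi_Jordan_Hoelder P r \<theta> N"
    have J: "length w = N" "distinct_adj w" if "w \<in> ?J" for w
      using that by (simp_all add: multi_Jordan_Hoelder_iff[OF inj])
    have len: "length B = N" if "map fst B \<in> ?J" for B :: "(nat \<times> nat set) list"
      using J(1)[OF that] by simp
    have sub: "fillings {w} m \<subseteq> X" if "w \<in> ?J" for w
      using that len by (auto simp: X_def fillings_def)
    \<comment> \<open>The lists with \<open>N\<close> blocks are sorted by their word, which each
      list determines; hence the union is disjoint.\<close>
    have "{B \<in> X. length B = N} = (\<Union>w\<in>?J. fillings {w} m)"
      using len by (auto simp: X_def fillings_def)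
    also have "card \<dots> = (\<Sum>w\<in>?J. card (fillings {w} m))"
    proof (rule card_UN_disjoint)
      show "\<forall>w\<in>?J. finite (fillings {w} m)" using sub fin finite_subset by blast
    qed (auto simp: finite_multi_Jordan_Hoelder[OF assms(1)] fillings_def)
    finally show ?thesis
      by (simp add: sum_fun_apply Ltilde_coeff J(2))
  qed
  ultimately show "((\<lambda>N. (\<Sum>w\<in>multi_Jordan_Hoelder P r \<theta> N. Ltilde (word_comp w)) m)
      has_sum Ktilde P r \<theta> m) {n..}"
    by simp
qed

end
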